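(* We have $$P(t,x,y,z)=\frac{2y}{1-yz}\left(P(t,x,z)-P\!\left(t,xyz,\frac1y\right)\right).$$
   Context: $\mathcal S_n$ is the set of permutations of $[n]=\{1,\dots,n\}$. A permutation in $\mathcal S_n$ is an odd order permutation if all its cycles (including fixed points) have odd length. For a cycle $c=(c_1c_2\cdots c_k)$, put $\mathrm{cdes}(c)=|\{i\in[k]: c_i>c_{i+1}\}|$ with $c_{k+1}=c_1$, and $\mathrm{casc}(c)=k-\mathrm{cdes}(c)$. Define $M(\pi)=\sum_c\min(\mathrm{cdes}(c),\mathrm{casc}(c))$, the sum over all cycles $c$ of $\pi$. A word $u$ is a factor of a word $w$ if $w=xuy$ for some (possibly empty) words $x,y$; $u$ is a cyclic factor of $\pi\in\mathcal S_n$ if $u$ is a factor of some word $v$ such that $(v)$ is a cycle of $\pi$ (any cyclic rotation of the cycle notation is allowed). $p_{n,d}(i,j)$ is the number of odd order permutations $\pi$ of length $n$ with $M(\pi)=d$ which have the word $i\,n\,j$ as a cyclic factor. Two formal power series, distinguished by their number of arguments, are defined: $$P(t,x,y)=\sum_{n\ge3}\sum_{d\ge0}\sum_{j=2}^{n-1}\frac{p_{n,d}(1,j)\,t^dx^ny^j}{(j-2)!\,(n-j-1)!},$$ $$P(t,x,y,z)=\sum_{n\ge3}\sum_{d\ge0}\ \sum_{1\le i<j\le n-1}\frac{2\,p_{n,d}(i,j)\,t^dx^ny^iz^j}{(j-i-1)!\,(n-j+i-2)!}.$$ Here $P(t,xyz,1/y)$ denotes the termwise substitution $x\mapsto xyz$,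 $y\mapsto 1/y$ in $P(t,x,y)$ (its terms contain only nonnegative powers of $y$), and $\frac1{1-yz}$ is expanded as a power series in $yz$. *)

theory Defs
  imports
    "HOL-Combinatorics.Permutations"
    "HOL-Library.Sublist"
    "HOL-Computational_Algebra.Formal_Power_Series"
begin

unbundle fps_syntax

text \<open>
  A permutation of $[n]$ is a function \<open>\<pi>\<close> with \<open>\<pi> permutes {1..n}\<close>.
  The words \<open>v\<close> such that $(v)$ is a cycle of \<open>\<pi>\<close>; all rotations of a cycle notation
  qualify, and a fixed point \<open>x\<close> yields the one-letter word \<open>[x]\<close>.
\<close>

definition cycle_word :: "nat \<Rightarrow> (nat \<Rightarrow> nat) \<Rightarrow> nat list \<Rightarrow> bool" where
  "cycle_word n \<pi> v \<longleftrightarrow>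
     v \<noteq> [] \<and> distinct v \<and> set v \<subseteq> {1..n} \<and>
     (\<forall>i<length v. \<pi> (v ! i) = v ! (Suc i mod length v))"

definition cdes :: "nat list \<Rightarrow> nat" where
  "cdes c = card {i. i < length c \<and> c ! i > c ! (Suc i mod length c)}"

definition casc :: "nat list \<Rightarrow> nat" where
  "casc c = length c - cdes c"

text \<open>
  Each cycle is represented by its unique notation starting with the smallest letter, so that
  sums over this set count every cycle exactly once.
\<close>

definition cycles :: "nat \<Rightarrow> (nat \<Rightarrow> nat) \<Rightarrow> nat list set" where
  "cycles n \<pi> = {c. cycle_word n \<pi> c \<and> hd c = Min (set c)}"

definition odd_order :: "nat \<Rightarrow> (nat \<Rightarrow> nat) \<Rightarrow> bool" where
  "odd_order n \<pi> \<longleftrightarrow> (\<forall>c\<in>cycles n \<pi>. odd (length c))"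

definition M_stat :: "nat \<Rightarrow> (nat \<Rightarrow> nat) \<Rightarrow> nat" where
  "M_stat n \<pi> = (\<Sum>c\<in>cycles n \<pi>. min (cdes c) (casc c))"

definition cyclic_factor :: "nat \<Rightarrow> nat list \<Rightarrow> (nat \<Rightarrow> nat) \<Rightarrow> bool" where
  "cyclic_factor n u \<pi> \<longleftrightarrow> (\<exists>v. cycle_word n \<pi> v \<and> sublist u v)"

definition p_count :: "nat \<Rightarrow> nat \<Rightarrow> nat \<Rightarrow> nat \<Rightarrow> nat" where
  "p_count n d i j = card {\<pi>. \<pi> permutes {1..n} \<and> odd_order n \<pi> \<and> M_stat n \<pi> = d \<and>
                              cyclic_factor n [i, n, j] \<pi>}"

text \<open>
  Power series in several variables are iterated univariate ones, with \<open>t\<close> outermost: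
  for a series \<open>F\<close> in $t,x,y$ the coefficient of $t^d x^n y^j$ is \<open>F $ d $ n $ j\<close>,
  for a series \<open>G\<close> in $t,x,y,z$ that of $t^d x^n y^i z^j$ is \<open>G $ d $ n $ i $ j\<close>.
\<close>

type_synonym series3 = "rat fps fps fps"
type_synonym series4 = "rat fps fps fps fps"

definition t3 :: series3 where "t3 = fps_X"
definition x3 :: series3 where "x3 = fps_const fps_X"
definition y3 :: series3 where "y3 = fps_const (fps_const fps_X)"

definition t4 :: series4 where "t4 = fps_X"
definition x4 :: series4 where "x4 = fps_const fps_X"
definition y4 :: series4 where "y4 = fps_const (fps_const fps_X)"
definition z4 :: series4 where "z4 = fps_const (fps_const (fps_const fps_X))"

definition P3 :: series3 where
  "P3 = Abs_fps (\<lambda>d. Abs_fps (\<lambda>n. Abs_fps (\<lambda>j.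
     if 3 \<le> n \<and> 2 \<le> j \<and> j \<le> n - 1
     then of_nat (p_count n d 1 j) / (fact (j - 2) * fact (n - j - 1))
     else 0)))"

definition P4 :: series4 where
  "P4 = Abs_fps (\<lambda>d. Abs_fps (\<lambda>n. Abs_fps (\<lambda>i. Abs_fps (\<lambda>j.
     if 3 \<le> n \<and> 1 \<le> i \<and> i < j \<and> j \<le> n - 1
     then 2 * of_nat (p_count n d i j) / (fact (j - i - 1) * fact (n - j + i - 2))
     else 0))))"

text \<open>\<open>subst_z F\<close> is $F(t,x,z)$, read as a series in $t,x,y,z$.\<close>

definition subst_z :: "series3 \<Rightarrow> series4" where
  "subst_z F = Abs_fps (\<lambda>d. Abs_fps (\<lambda>n. Abs_fps (\<lambda>i. Abs_fps (\<lambda>j.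
     if i = 0 then F $ d $ n $ j else 0))))"

text \<open>
  \<open>subst_xyz_inv F\<close> is $F(t,xyz,1/y)$: the term $t^d x^n y^k$ of \<open>F\<close> becomes
  $t^d x^n y^{n-k} z^n$, i.e. $t^d x^n y^i z^j$ arises exactly when $j = n$ and $i = n - k$.
  Only series all of whose terms satisfy $k \le n$ (such as \<open>P3\<close>) are meant; terms with
  $k > n$ would leave the ring of power series and are dropped.
\<close>

definition subst_xyz_inv :: "series3 \<Rightarrow> series4" where
  "subst_xyz_inv F = Abs_fps (\<lambda>d. Abs_fps (\<lambda>n. Abs_fps (\<lambda>i. Abs_fps (\<lambda>j.
     if j = n \<and> i \<le> n then F $ d $ n $ (n - i) else 0))))"

lemma fps_X_power_mult_const_nth:
  "(fps_X ^ d * fps_const a) $ k = (if k = d then a else (0 :: 'a :: comm_ring_1))"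
  by (auto simp: fps_X_power_mult_nth)

lemma monomial3_nth:
  "(t3 ^ d * x3 ^ n * y3 ^ k) $ d' $ n' $ k' = (if d' = d \<and> n' = n \<and> k' = k then 1 else 0)"
proof -
  have "t3 ^ d * x3 ^ n * y3 ^ k = fps_X ^ d * fps_const (fps_X ^ n * fps_const (fps_X ^ k))"
    by (simp add: t3_def x3_def y3_def fps_const_power mult.assoc flip: fps_const_mult)
  thus ?thesis
    by (simp only: fps_X_power_mult_const_nth) (simp add: fps_X_power_mult_const_nth)
qed

lemma monomial4_nth:
  "(t4 ^ d * x4 ^ n * y4 ^ i * z4 ^ j) $ d' $ n' $ i' $ j' =
     (if d' = d \<and> n' = n \<and> i' = i \<and> j' = j then 1 else 0)"
proof -
  have "t4 ^ d * x4 ^ n * y4 ^ i * z4 ^ j =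
      fps_X ^ d * fps_const (fps_X ^ n * fps_const (fps_X ^ i * fps_const (fps_X ^ j)))"
    by (simp add: t4_def x4_def y4_def z4_def fps_const_power mult.assoc flip: fps_const_mult)
  thus ?thesis
    by (simp only: fps_X_power_mult_const_nth) (simp add: fps_X_power_mult_const_nth)
qed

lemma subst_z_monomial:
  "subst_z (t3 ^ d * x3 ^ n * y3 ^ k) = t4 ^ d * x4 ^ n * z4 ^ k"
  using monomial4_nth[of d n 0 k]
  by (auto simp: fps_eq_iff subst_z_def monomial3_nth)

lemma subst_xyz_inv_monomial:
  assumes "k \<le> n"
  shows "subst_xyz_inv (t3 ^ d * x3 ^ n * y3 ^ k) * y4 ^ k = t4 ^ d * (x4 * y4 * z4) ^ n"
proof -
  have "subst_xyz_inv (t3 ^ d * x3 ^ n * y3 ^ k) = t4 ^ d * x4 ^ n * y4 ^ (n - k) * z4 ^ n"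
    using assms by (auto simp: fps_eq_iff subst_xyz_inv_def monomial3_nth monomial4_nth)
  moreover have "y4 ^ n = y4 ^ (n - k) * y4 ^ k"
    using assms by (simp flip: power_add)
  ultimately show ?thesis
    by (simp add: power_mult_distrib ac_simps)
qed

text \<open>The library inverse of \<open>1 - y4 * z4\<close> in the iterated ring is the expansion of $1/(1-yz)$.\<close>

lemma inverse_one_minus_yz: "inverse (1 - y4 * z4) * (1 - y4 * z4) = 1"
proof -
  define g :: "rat fps fps" where "g = 1 - fps_X * fps_const fps_X"
  have "inverse g * g = 1"
    unfolding fps_inverse_def[of g]
    by (rule fps_left_inverse'[where x = 1]) (simp_all add: g_def)
  moreover have "1 - y4 * z4 = fps_const (fps_const g)"
    by (simp add: y4_def z4_def g_def flip: fps_const_sub)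
  ultimately show ?thesis
    by (simp add: fps_const_inverse)
qed

end

(*
  Clearing the denominator 1 - yz and comparing coefficients reduces the identity to
  p_{n,d}(i,j) = p_{n,d}(i+1,j+1) for i, j <= n-2. Conjugation by the cycle (1 2 ... n-1)
  is a bijection between the two families of permutations: the factor i n j becomes
  (i+1) n (j+1), and all comparisons of cyclically adjacent letters are kept except those with
  n-1. Since n-1 is not adjacent to n, it is a local maximum of its cycle and turns into the
  letter 1, a local minimum, so the number of cyclic descents of each cycle is unchanged.
*)
theory Submission
  imports Defs
begin

section \<open>Cycle statistics in terms of supports\<close>

text \<open>Supports do not depend on the rotation of a cycle word, and conjugation acts on them by
  taking images. The minimum-first words in \<open>cycles\<close> lack the second property, since
  relabelling can move the minimum.\<close>

definition cycle_sets :: "nat \<Rightarrow> (nat \<Rightarrow> nat) \<Rightarrow> nat set set" where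
  "cycle_sets n \<pi> = set ` {v. cycle_word n \<pi> v}"

text \<open>On the support of a cycle of \<pi> this is its cyclic descent number, each descent being
  recorded by its larger letter.\<close>

definition descents_on :: "(nat \<Rightarrow> nat) \<Rightarrow> nat set \<Rightarrow> nat" where
  "descents_on \<pi> S = card {x\<in>S. x > \<pi> x}"

lemma cycle_word_rotate:
  assumes "cycle_word n \<pi> v"
  shows "cycle_word n \<pi> (rotate k v)"
proof -
  have "\<pi> (rotate k v ! i) = rotate k v ! (Suc i mod length v)" if "i < length v" for i
  proof -
    have "v \<noteq> []" using assms by (simp add: cycle_word_def)
    have "\<pi> (rotate k v ! i) = v ! (Suc ((k + i) mod length v) mod length v)"
      using assms that by (simp add: cycle_word_def nth_rotate)
    also have "Suc ((k + i) mod length v) mod length v = (k + Suc i mod length v) mod length v"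
      by (simp add: mod_Suc_eq mod_add_right_eq)
    also have "v ! \<dots> = rotate k v ! (Suc i mod length v)"
      using \<open>v \<noteq> []\<close> by (simp add: nth_rotate)
    finally show ?thesis .
  qed
  thus ?thesis using assms by (simp add: cycle_word_def)
qed

lemma set_image_cycles: "set ` cycles n \<pi> = cycle_sets n \<pi>"
proof
  show "cycle_sets n \<pi> \<subseteq> set ` cycles n \<pi>"
  proof
    fix S assume "S \<in> cycle_sets n \<pi>"
    then obtain v where v: "cycle_word n \<pi> v" "S = set v"
      by (auto simp: cycle_sets_def)
    hence "Min (set v) \<in> set v" by (simp add: cycle_word_def)
    then obtain k where k: "k < length v" "v ! k = Min (set v)"
      by (auto simp: in_set_conv_nth)
    have "v \<noteq> []" using k by auto
    hence "hd (rotate k v) = Min (set v)"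
      using k by (simp add: hd_rotate_conv_nth)
    hence "rotate k v \<in> cycles n \<pi>"
      using cycle_word_rotate[OF v(1)] by (simp add: cycles_def)
    thus "S \<in> set ` cycles n \<pi>"
      using v(2) by (metis image_eqI set_rotate)
  qed
qed (auto simp: cycles_def cycle_sets_def)

lemma cycle_word_step:
  assumes "cycle_word n \<pi> v" "Suc k < length v"
  shows "\<pi> (v ! k) = v ! Suc k"
  using assms mod_less[OF assms(2)] by (simp add: cycle_word_def)

lemma cycle_word_nth:
  assumes "cycle_word n \<pi> v" "k < length v"
  shows "v ! k = (\<pi> ^^ k) (hd v)"
  using assms(2)
proof (induction k)
  case 0
  thus ?case by (simp add: hd_conv_nth)
next
  case (Suc k)
  hence "v ! Suc k = \<pi> (v ! k)" using cycle_word_step[OF assms(1)] by metis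
  also have "v ! k = (\<pi> ^^ k) (hd v)" using Suc by simp
  finally show ?case by simp
qed

text \<open>A cycle word lists the iterates of \<pi> on its first letter. The support determines
  that letter, as its minimum, and the length, as its cardinality.\<close>

lemma inj_on_set_cycles: "inj_on set (cycles n \<pi>)"
proof (rule inj_onI)
  fix v w assume vw: "v \<in> cycles n \<pi>" "w \<in> cycles n \<pi>" and eq: "set v = set w"
  have "length v = length w"
    using vw eq by (metis (mono_tags, lifting) cycles_def cycle_word_def distinct_card mem_Collect_eq)
  moreover have "hd v = hd w" using vw eq by (simp add: cycles_def)
  ultimately show "v = w"
    using vw cycle_word_nth by (auto intro!: nth_equalityI simp: cycles_def)
qed

lemma cycle_word_length: "cycle_word n \<pi> v \<Longrightarrow> length v = card (set v)"
  by (simp add: cycle_word_def distinct_card)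

lemma cdes_cycle_word:
  assumes "cycle_word n \<pi> v"
  shows "cdes v = descents_on \<pi> (set v)"
proof -
  have "bij_betw ((!) v) {i. i < length v \<and> v ! i > v ! (Suc i mod length v)} {x\<in>set v. x > \<pi> x}"
    using assms by (fastforce simp: bij_betw_def cycle_word_def inj_on_nth in_set_conv_nth
        intro: inj_on_subset)
  thus ?thesis unfolding cdes_def descents_on_def by (rule bij_betw_same_card)
qed

lemma M_stat_cycle_sets:
  "M_stat n \<pi> = (\<Sum>S\<in>cycle_sets n \<pi>. min (descents_on \<pi> S) (card S - descents_on \<pi> S))"
  unfolding M_stat_def set_image_cycles[symmetric] sum.reindex[OF inj_on_set_cycles]
  by (rule sum.cong) (auto simp: cycles_def casc_def cdes_cycle_word cycle_word_length)

lemma odd_order_cycle_sets: "odd_order n \<pi> \<longleftrightarrow> (\<forall>S\<in>cycle_sets n \<pi>. odd (card S))"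
  unfolding odd_order_def set_image_cycles[symmetric]
  by (auto simp: cycles_def cycle_word_length)

lemma cycle_sets_subset: "S \<in> cycle_sets n \<pi> \<Longrightarrow> S \<subseteq> {1..n}"
  by (auto simp: cycle_sets_def cycle_word_def)

lemma cycle_sets_image:
  assumes "S \<in> cycle_sets n \<pi>"
  shows "\<pi> ` S = S"
proof -
  obtain v where v: "cycle_word n \<pi> v" "S = set v" using assms by (auto simp: cycle_sets_def)
  \<comment> \<open>Applying \<pi> letter by letter moves the cycle on by one place.\<close>
  hence "map \<pi> v = rotate1 v"
    by (auto intro!: nth_equalityI simp: cycle_word_def nth_rotate1)
  thus ?thesis using v(2) by (metis list.set_map set_rotate1)
qed

lemma cyclic_factor_imp:
  assumes "cyclic_factor n [a, b, c] \<pi>"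
  shows "\<pi> a = b" "\<pi> b = c"
proof -
  obtain v xs ys where v: "cycle_word n \<pi> v" "v = xs @ [a, b, c] @ ys"
    using assms by (auto simp: cyclic_factor_def sublist_def)
  have "\<pi> (v ! length xs) = v ! Suc (length xs)"
    "\<pi> (v ! Suc (length xs)) = v ! Suc (Suc (length xs))"
    using v(2) by (intro cycle_word_step[OF v(1)]; simp)+
  thus "\<pi> a = b" "\<pi> b = c" using v(2) by (simp_all add: nth_append)
qed

section \<open>Conjugation\<close>

lemma cycle_word_conj:
  assumes \<sigma>: "\<sigma> permutes {1..n}"
  shows "cycle_word n (\<sigma> \<circ> \<pi> \<circ> inv \<sigma>) (map \<sigma> v) \<longleftrightarrow> cycle_word n \<pi> v"
proof -
  have inj: "inj \<sigma>" using \<sigma> by (rule permutes_inj)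
  have "set (map \<sigma> v) \<subseteq> {1..n} \<longleftrightarrow> set v \<subseteq> {1..n}"
    using permutes_in_image[OF \<sigma>] by auto
  moreover have "map \<sigma> v ! (Suc i mod length v) = \<sigma> (v ! (Suc i mod length v))"
    if "i < length v" for i
    using that by (intro nth_map mod_less_divisor) auto
  ultimately show ?thesis
    using inj by (auto simp: cycle_word_def distinct_map inj_eq intro: inj_on_subset)
qed

lemma cycle_sets_conj:
  assumes \<sigma>: "\<sigma> permutes {1..n}"
  shows "cycle_sets n (\<sigma> \<circ> \<pi> \<circ> inv \<sigma>) = (`) \<sigma> ` cycle_sets n \<pi>"
proof -
  \<comment> \<open>Every word is a relabelled one, so the equivalence for single words gives an
    equality of sets.\<close>
  have "surj (map \<sigma>)"
    by (rule surjI[where f = "map (inv \<sigma>)"])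
      (simp add: permutes_surj[OF \<sigma>] o_def surj_f_inv_f map_idI)
  hence "{v. cycle_word n (\<sigma> \<circ> \<pi> \<circ> inv \<sigma>) v} = map \<sigma> ` {v. cycle_word n \<pi> v}"
    using cycle_word_conj[OF \<sigma>, of \<pi>] by (auto simp: image_iff) (metis surjD)
  thus ?thesis by (simp add: cycle_sets_def image_image)
qed

lemma cyclic_factor_conj:
  assumes \<sigma>: "\<sigma> permutes {1..n}"
  shows "cyclic_factor n (map \<sigma> u) (\<sigma> \<circ> \<pi> \<circ> inv \<sigma>) \<longleftrightarrow> cyclic_factor n u \<pi>"
proof
  assume "cyclic_factor n u \<pi>"
  thus "cyclic_factor n (map \<sigma> u) (\<sigma> \<circ> \<pi> \<circ> inv \<sigma>)"
    unfolding cyclic_factor_def using cycle_word_conj[OF \<sigma>, of \<pi>] by (blast intro: map_mono_sublist)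
next
  assume "cyclic_factor n (map \<sigma> u) (\<sigma> \<circ> \<pi> \<circ> inv \<sigma>)"
  then obtain w where w: "cycle_word n (\<sigma> \<circ> \<pi> \<circ> inv \<sigma>) w" "sublist (map \<sigma> u) w"
    by (auto simp: cyclic_factor_def)
  have "map \<sigma> (map (inv \<sigma>) w) = w"
    using \<sigma> by (simp add: permutes_surj o_def surj_f_inv_f map_idI)
  hence "cycle_word n \<pi> (map (inv \<sigma>) w)"
    using w(1) cycle_word_conj[OF \<sigma>, of \<pi> "map (inv \<sigma>) w"] by simp
  moreover have "sublist u (map (inv \<sigma>) w)"
    using map_mono_sublist[OF w(2), of "inv \<sigma>"] \<sigma> by (simp add: permutes_inj map_idI)
  ultimately show "cyclic_factor n u \<pi>" by (auto simp: cyclic_factor_def)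
qed

lemma bij_betw_conj:
  assumes \<sigma>: "\<sigma> permutes A"
  shows "bij_betw (\<lambda>\<pi>. \<sigma> \<circ> \<pi> \<circ> inv \<sigma>) {\<pi>. \<pi> permutes A} {\<pi>. \<pi> permutes A}"
proof (rule bij_betwI[where g = "\<lambda>\<pi>. inv \<sigma> \<circ> \<pi> \<circ> \<sigma>"])
  show "inv \<sigma> \<circ> (\<sigma> \<circ> \<pi> \<circ> inv \<sigma>) \<circ> \<sigma> = \<pi>" for \<pi>
    using permutes_inverses[OF \<sigma>] by (simp add: fun_eq_iff)
  show "\<sigma> \<circ> (inv \<sigma> \<circ> \<pi> \<circ> \<sigma>) \<circ> inv \<sigma> = \<pi>" for \<pi>
    using permutes_inverses[OF \<sigma>] by (simp add: fun_eq_iff)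
qed (use \<sigma> in \<open>auto intro!: permutes_compose permutes_inv\<close>)

lemma odd_order_conj:
  assumes \<sigma>: "\<sigma> permutes {1..n}"
  shows "odd_order n (\<sigma> \<circ> \<pi> \<circ> inv \<sigma>) \<longleftrightarrow> odd_order n \<pi>"
  using \<sigma> by (simp add: odd_order_cycle_sets cycle_sets_conj card_image[OF permutes_inj_on])

lemma descents_on_conj:
  assumes \<sigma>: "\<sigma> permutes A"
  shows "descents_on (\<sigma> \<circ> \<pi> \<circ> inv \<sigma>) (\<sigma> ` S) = card {x\<in>S. \<sigma> x > \<sigma> (\<pi> x)}"
proof -
  have "{x\<in>\<sigma> ` S. x > (\<sigma> \<circ> \<pi> \<circ> inv \<sigma>) x} = \<sigma> ` {x\<in>S. \<sigma> x > \<sigma> (\<pi> x)}"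
    using permutes_inverses[OF \<sigma>] by auto
  thus ?thesis using \<sigma> by (simp add: descents_on_def card_image[OF permutes_inj_on])
qed

text \<open>Relabelling keeps the size of each support, so only the descent counts remain to be
  compared.\<close>

lemma M_stat_conj:
  assumes \<sigma>: "\<sigma> permutes {1..n}"
    and descents: "\<And>S. S \<in> cycle_sets n \<pi> \<Longrightarrow> card {x\<in>S. \<sigma> x > \<sigma> (\<pi> x)} = descents_on \<pi> S"
  shows "M_stat n (\<sigma> \<circ> \<pi> \<circ> inv \<sigma>) = M_stat n \<pi>"
proof -
  have "inj_on ((`) \<sigma>) (cycle_sets n \<pi>)"
    using permutes_inj[OF \<sigma>] by (meson inj_image_eq_iff inj_onI)
  thus ?thesis
    using \<sigma> by (simp add: M_stat_cycle_sets cycle_sets_conj sum.reindex descents_on_conj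
        card_image[OF permutes_inj_on] descents cong: sum.cong)
qed

section \<open>Shifting the letters below the largest one\<close>

text \<open>For m \<ge> 1 this is the cycle (1 2 ... m). It is applied with m = n - 1, so that n
  stays in place.\<close>

definition cyc_shift :: "nat \<Rightarrow> nat \<Rightarrow> nat" where
  "cyc_shift m x = (if x = m then 1 else if 1 \<le> x \<and> x < m then Suc x else x)"

lemma cyc_shift_permutes:
  assumes "1 \<le> m"
  shows "cyc_shift m permutes {1..m}"
proof (rule bij_imp_permutes)
  have "inj_on (cyc_shift m) {1..m}" by (auto simp: inj_on_def cyc_shift_def)
  moreover have "cyc_shift m ` {1..m} \<subseteq> {1..m}" using assms by (auto simp: cyc_shift_def)
  ultimately show "bij_betw (cyc_shift m) {1..m} {1..m}"
    by (simp add: bij_betw_def endo_inj_surj)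
qed (use assms in \<open>auto simp: cyc_shift_def\<close>)

text \<open>If m is moved by \<pi>, the step into m turns from an ascent into a descent and the step
  out of m from a descent into an ascent. All other comparisons survive, so the two changes
  cancel.\<close>

lemma card_descents_cyc_shift:
  assumes S: "S \<subseteq> {1..Suc m}" "\<pi> ` S = S"
    and inj: "inj \<pi>" and not_adjacent: "\<pi> m \<noteq> Suc m" "\<pi> (Suc m) \<noteq> m"
  shows "card {x\<in>S. cyc_shift m x > cyc_shift m (\<pi> x)} = descents_on \<pi> S" (is "card ?D' = _")
proof -
  let ?D = "{x\<in>S. x > \<pi> x}"
  have "finite S" using S(1) by (rule finite_subset) simp
  have closed: "\<pi> x \<in> S" if "x \<in> S" for x using S(2) that by blast
  have range: "1 \<le> x" "x \<le> Suc m" if "x \<in> S" for x using S(1) that by auto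
  \<comment> \<open>Away from m the shift is strictly increasing: letters below m rise by one, to at
    most m, and \<open>Suc m\<close> is fixed.\<close>
  have mono: "cyc_shift m x > cyc_shift m (\<pi> x) \<longleftrightarrow> x > \<pi> x"
    if "x \<in> S" "x \<noteq> m" "\<pi> x \<noteq> m" for x
    using range[OF that(1)] range[OF closed[OF that(1)]] that(2,3) by (auto simp: cyc_shift_def)
  show ?thesis
  proof (cases "m \<in> S \<and> \<pi> m \<noteq> m")
    case False
    \<comment> \<open>No letter other than m can be mapped to m here, and a fixed point is a descent
      neither before nor after the shift.\<close>
    hence "?D' = ?D"
      using mono inj closed by (metis (lifting) injD order_less_irrefl)
    thus ?thesis by (simp add: descents_on_def)
  next
    case True
    then obtain a where a: "a \<in> S" "\<pi> a = m" using S(2) by (metis imageE)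
    have "a \<noteq> m" "a \<noteq> Suc m" using a True not_adjacent by auto
    have pm: "\<pi> m < m" "1 \<le> \<pi> m" using range[OF closed, of m] True not_adjacent by auto
    \<comment> \<open>The letter m becomes 1 and loses its descent; its predecessor
      \<open>a\<close>, which is below m, gains one.\<close>
    have "?D' = insert a (?D - {m})"
    proof (rule set_eqI)
      fix x
      consider "x = m" | "x = a" | "x \<noteq> m" "x \<noteq> a" by blast
      thus "x \<in> ?D' \<longleftrightarrow> x \<in> insert a (?D - {m})"
      proof cases
        case 1
        thus ?thesis using pm \<open>a \<noteq> m\<close> by (simp add: cyc_shift_def)
      next
        case 2
        thus ?thesis using a \<open>a \<noteq> m\<close> \<open>a \<noteq> Suc m\<close> range[OF a(1)] by (simp add: cyc_shift_def)
      next
        case 3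
        hence "\<pi> x \<noteq> m" using a inj by (metis injD)
        thus ?thesis using 3 mono by blast
      qed
    qed
    moreover have "a \<notin> ?D" and "m \<in> ?D"
      using a pm True range[OF a(1)] \<open>a \<noteq> m\<close> \<open>a \<noteq> Suc m\<close> by auto
    moreover have "finite ?D" using \<open>finite S\<close> by simp
    moreover have "card (insert a (?D - {m})) = Suc (card (?D - {m}))"
      using \<open>a \<notin> ?D\<close> \<open>finite ?D\<close> by (intro card_insert_disjoint) blast+
    ultimately have "card ?D' = Suc (card (?D - {m}))" by simp
    also have "\<dots> = card ?D" by (rule card_Suc_Diff1) fact+
    finally show ?thesis by (simp add: descents_on_def)
  qed
qed

text \<open>The bounds by n - 2 make the shift raise both i and j by one, and they keep n - 1 from
  being a neighbour of n.\<close>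

lemma p_count_shift:
  assumes "1 \<le> i" "1 \<le> j" "i \<le> n - 2" "j \<le> n - 2"
  shows "p_count n d i j = p_count n d (Suc i) (Suc j)"
proof -
  define m where "m = n - 1"
  define \<sigma> where "\<sigma> = cyc_shift m"
  have n: "n = Suc m" "i < m" "j < m" "1 \<le> m" using assms by (auto simp: m_def)
  have \<sigma>: "\<sigma> permutes {1..n}"
    unfolding \<sigma>_def using cyc_shift_permutes[OF n(4)] by (rule permutes_subset) (use n in auto)
  let ?Q = "\<lambda>i j \<pi>. odd_order n \<pi> \<and> M_stat n \<pi> = d \<and> cyclic_factor n [i, n, j] \<pi>"
  let ?conj = "\<lambda>\<pi>. \<sigma> \<circ> \<pi> \<circ> inv \<sigma>"
  have "map \<sigma> [i, n, j] = [Suc i, n, Suc j]"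
    using n assms by (simp add: \<sigma>_def cyc_shift_def)
  hence factor: "cyclic_factor n [Suc i, n, Suc j] (?conj \<pi>) \<longleftrightarrow> cyclic_factor n [i, n, j] \<pi>" for \<pi>
    using cyclic_factor_conj[OF \<sigma>] by metis
  have M: "M_stat n (?conj \<pi>) = M_stat n \<pi>"
    if \<pi>: "\<pi> permutes {1..n}" and f: "cyclic_factor n [i, n, j] \<pi>" for \<pi>
  proof (rule M_stat_conj[OF \<sigma>])
    fix S assume S: "S \<in> cycle_sets n \<pi>"
    have inj: "inj \<pi>" using \<pi> by (rule permutes_inj)
    have "\<pi> m \<noteq> Suc m" "\<pi> (Suc m) \<noteq> m"
      using cyclic_factor_imp[OF f] n injD[OF inj, of i m] by auto
    thus "card {x\<in>S. \<sigma> x > \<sigma> (\<pi> x)} = descents_on \<pi> S"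
      unfolding \<sigma>_def using cycle_sets_subset[OF S] cycle_sets_image[OF S] inj n
      by (intro card_descents_cyc_shift) auto
  qed
  have "?Q (Suc i) (Suc j) (?conj \<pi>) \<longleftrightarrow> ?Q i j \<pi>" if "\<pi> permutes {1..n}" for \<pi>
    using factor M[OF that] odd_order_conj[OF \<sigma>] by metis
  hence "bij_betw ?conj {\<pi> \<in> {\<pi>. \<pi> permutes {1..n}}. ?Q i j \<pi>}
      {\<pi> \<in> {\<pi>. \<pi> permutes {1..n}}. ?Q (Suc i) (Suc j) \<pi>}"
    by (intro bij_betw_Collect[OF bij_betw_conj[OF \<sigma>]]) auto
  thus ?thesis unfolding p_count_def by (auto dest: bij_betw_same_card)
qed

lemma p_count_shift_add:
  assumes "1 \<le> i" "1 \<le> j" "i + k \<le> n - 1" "j + k \<le> n - 1"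
  shows "p_count n d (i + k) (j + k) = p_count n d i j"
  using assms
proof (induction k)
  case (Suc k)
  thus ?case using p_count_shift[of "i + k" "j + k" n d] by simp
qed simp

section \<open>Comparison of coefficients\<close>

lemma y4_mult_nth: "(y4 * F) $ d $ n $ i $ j = (if i = 0 then 0 else F $ d $ n $ (i - 1) $ j)"
  by (simp add: y4_def)

lemma z4_mult_nth: "(z4 * F) $ d $ n $ i $ j = (if j = 0 then 0 else F $ d $ n $ i $ (j - 1))"
  by (simp add: z4_def)

text \<open>Shifting down by i - 1 turns the first letter into 1. Within the range the coefficient,
  factorials included, thus depends on i and j only through j - i.\<close>

lemma P4_nth:
  "P4 $ d $ n $ i $ j =
     (if 3 \<le> n \<and> 1 \<le> i \<and> i < j \<and> j \<le> n - 1
      then 2 * of_nat (p_count n d 1 (Suc (j - i))) / (fact (j - i - 1) * fact (n - j + i - 2))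
      else 0)"
proof (cases "3 \<le> n \<and> 1 \<le> i \<and> i < j \<and> j \<le> n - 1")
  case True
  hence "1 + (i - 1) = i" "Suc (j - i) + (i - 1) = j" by linarith+
  with True have "p_count n d i j = p_count n d 1 (Suc (j - i))"
    using p_count_shift_add[of 1 "Suc (j - i)" "i - 1" n d] by simp
  with True show ?thesis by (simp add: P4_def)
qed (auto simp: P4_def)

text \<open>The factor 1 - yz subtracts from each coefficient the one at (i-1, j-1). The differences
  telescope along diagonals: the entry at i = 1 yields P(t,x,z), the exit at j = n yields
  -P(t,xyz,1/y).\<close>

lemma P4_mult_one_minus_yz: "P4 * (1 - y4 * z4) = 2 * y4 * (subst_z P3 - subst_xyz_inv P3)"
proof -
  let ?G = "subst_z P3 - subst_xyz_inv P3"
  have "(P4 - y4 * (z4 * P4)) $ d $ n $ i $ j = 2 * (y4 * ?G) $ d $ n $ i $ j" for d n i j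
  proof -
    consider "i = 0" | "i = 1" | "2 \<le> i" "j = n" | "2 \<le> i" "j \<noteq> n" by linarith
    thus ?thesis
    proof cases
      case 1
      thus ?thesis by (simp add: y4_mult_nth P4_nth)
    next
      \<comment> \<open>The subtracted term has i = 0 and vanishes. \<open>subst_xyz_inv\<close>
        could contribute only for j = n, where it reads the coefficient of y^n in \<open>P3\<close>,
        which is 0.\<close>
      case 2
      thus ?thesis
        by (auto simp: y4_mult_nth z4_mult_nth P4_nth P3_def subst_z_def subst_xyz_inv_def
            Suc_diff_Suc numeral_2_eq_2)
    next
      case 3
      \<comment> \<open>The index n - (i - 1) read from \<open>P3\<close> has to match the second
        letter \<open>Suc (n - i)\<close> that \<open>P4_nth\<close> gives at (i-1, n-1).\<close>
      hence "i \<le> n \<Longrightarrow> Suc n - i = Suc (n - i)" by linarith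
      with 3 show ?thesis
        by (auto simp: y4_mult_nth z4_mult_nth P4_nth P3_def subst_z_def subst_xyz_inv_def
            numeral_2_eq_2)
    next
      \<comment> \<open>The points (i, j) and (i-1, j-1) are both in the range or both outside
        it.\<close>
      case 4
      thus ?thesis
        by (auto simp: y4_mult_nth z4_mult_nth P4_nth P3_def subst_z_def subst_xyz_inv_def)
    qed
  qed
  hence "P4 - y4 * (z4 * P4) = y4 * ?G + y4 * ?G"
    by (simp only: fps_eq_iff fps_add_nth mult_2) blast
  thus ?thesis by (simp add: algebra_simps)
qed

theorem theorem4p1:
  shows "P4 = 2 * y4 * inverse (1 - y4 * z4) * (subst_z P3 - subst_xyz_inv P3)"
proof -
  have "P4 = P4 * (inverse (1 - y4 * z4) * (1 - y4 * z4))"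
    by (simp only: inverse_one_minus_yz mult_1_right)
  also have "\<dots> = inverse (1 - y4 * z4) * (P4 * (1 - y4 * z4))"
    by (simp only: ac_simps)
  finally show ?thesis by (simp only: P4_mult_one_minus_yz ac_simps)
qed

end
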